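(* Let $\lambda\in\mathbb{R}$. For every integer $p\ge 0$, as an identity of power series in $t$, $$\sum_{n=0}^{\infty}\beta_{n,\lambda}^{(p)}\frac{t^{n}}{n!}=(p+1)\int_{0}^{1}(1-x)^{p}\big(1-x(1-e_{\lambda}(t))\big)^{\lambda-1}\,dx.$$
   Context: For real $\mu$ and $x$: $(x)_{0,\mu}=1$ and $(x)_{n,\mu}=x(x-\mu)(x-2\mu)\cdots(x-(n-1)\mu)$ for $n\ge 1$. Also $\langle a\rangle_0=1$, $\langle a\rangle_k=a(a+1)\cdots(a+k-1)$ for $k\ge1$. The degenerate exponential is the power series $e_\lambda(t)=\sum_{n\ge0}(1)_{n,\lambda}\frac{t^n}{n!}$. The Gauss hypergeometric series is ${}_2F_1(a,b;c;x)=\sum_{k\ge0}\frac{\langle a\rangle_k\langle b\rangle_k}{\langle c\rangle_k}\frac{x^k}{k!}$. For an integer $p\ge-1$, the generalized degenerate Bernoulli numbers $\beta_{n,\lambda}^{(p)}$ ($n\ge0$) are defined by the identity of formal power series in $t$ $${}_2F_1\big(1-\lambda,1;p+2;1-e_\lambda(t)\big)=\sum_{n=0}^\infty\beta_{n,\lambda}^{(p)}\frac{t^n}{n!}.$$ On the right-hand side of the claim, $\big(1-x(1-e_\lambda(t))\big)^{\lambda-1}$ is expanded by the binomial series $\sum_{k\ge0}\binom{\lambda-1}{k}(-x)^k(1-e_\lambda(t))^k$ as a power series in $t$ whose coefficients are polynomials in $x$, and the integral over $x\in[0,1]$ is taken coefficientwise. *)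

theory Defs
  imports "HOL-Analysis.Analysis"
begin

definition deg_falling :: "real \<Rightarrow> real \<Rightarrow> nat \<Rightarrow> real" where
  "deg_falling mu x n = (\<Prod>i<n. x - real i * mu)"

definition deg_exp :: "real \<Rightarrow> real fps" where
  "deg_exp lam = Abs_fps (\<lambda>n. deg_falling lam 1 n / fact n)"

(* The trailing argument 1 of fps_hypergeo is a scaling of the series variable.
   The composition is meaningful because 1 - deg_exp lam has constant term 0.
   Intended for p \<ge> -1; for smaller p a denominator may vanish. *)
definition deg_bernoulli :: "real \<Rightarrow> int \<Rightarrow> nat \<Rightarrow> real" where
  "deg_bernoulli lam p n =
     fact n * fps_nth (fps_compose (fps_hypergeo [1 - lam, 1] [of_int p + 2] 1) (1 - deg_exp lam)) n"

(* Power series in t with coefficients in the polynomial ring in x are of type real poly fps;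
   the polynomial x itself is [:0, 1:]. *)
definition fps_const_coeffs :: "real fps \<Rightarrow> real poly fps" where
  "fps_const_coeffs F = Abs_fps (\<lambda>n. [:fps_nth F n:])"

(* (1 - x (1 - deg_exp lam)) to the power lam - 1, as the binomial series
   \<Sum>k. ((lam - 1) gchoose k) (-x)^k u^k composed with u = 1 - deg_exp lam. *)
definition deg_binomial_power :: "real \<Rightarrow> real poly fps" where
  "deg_binomial_power lam =
     fps_compose (Abs_fps (\<lambda>k. smult ((lam - 1) gchoose k) ((- [:0, 1:]) ^ k)))
       (fps_const_coeffs (1 - deg_exp lam))"

definition fps_integral_coeffwise :: "real poly fps \<Rightarrow> real fps" where
  "fps_integral_coeffwise F = Abs_fps (\<lambda>n. integral {0..1} (\<lambda>x. poly (fps_nth F n) x))"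

end

theory Submission
  imports Defs
begin

text \<open>
  Expanding the binomial power and integrating term by term turns each \<open>x\<^sup>k (1 - x)\<^sup>p\<close> into the
  Beta value \<open>k! p! / (k + p + 1)!\<close>. Since \<open>binomial (\<lambda> - 1, k) (-1)\<^sup>k = \<langle>1 - \<lambda>\<rangle>\<^sub>k / k!\<close>, the factor
  \<open>p + 1\<close> turns the result into the \<open>k\<close>-th coefficient of the hypergeometric series.
\<close>

lemma fps_const_coeffs_nth: "fps_nth (fps_const_coeffs F) n = [:fps_nth F n:]"
  by (simp add: fps_const_coeffs_def)

lemma fps_const_coeffs_mult:
  "fps_const_coeffs (F * G) = fps_const_coeffs F * fps_const_coeffs G"
  by (rule fps_ext)
    (simp add: fps_const_coeffs_nth fps_mult_nth poly_eq_iff coeff_sum coeff_pCons mult.commute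
      split: nat.split)

text \<open>Lets powers of \<open>1 - deg_exp lam\<close> be computed over the reals, so that in the
  binomial series \<open>x\<close> enters only through the explicit factor
  \<open>(-x) ^ k\<close>.\<close>

lemma fps_const_coeffs_power: "fps_const_coeffs (F ^ k) = fps_const_coeffs F ^ k"
proof (induction k)
  case 0
  show ?case by (rule fps_ext) (simp add: fps_const_coeffs_nth)
next
  case (Suc k)
  then show ?case by (simp add: fps_const_coeffs_mult)
qed

text \<open>Euler's Beta integral at \<open>k + 1\<close> and \<open>p + 1\<close>, where the Gamma
  values are factorials.\<close>

lemma has_integral_power_mult_one_minus_power:
  "((\<lambda>x::real. x ^ k * (1 - x) ^ p) has_integral fact k * fact p / fact (k + p + 1)) {0..1}"
proof -
  have B: "Beta (real k + 1) (real p + 1) = fact k * fact p / fact (k + p + 1)"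
    using Gamma_fact[of k, where 'a = real] Gamma_fact[of p, where 'a = real]
      Gamma_fact[of "k + p + 1", where 'a = real]
    by (simp add: Beta_def add_ac)
  have "((\<lambda>x::real. x powr (real k + 1 - 1) * (1 - x) powr (real p + 1 - 1))
      has_integral fact k * fact p / fact (k + p + 1)) {0..1}"
    using has_integral_Beta_real[of "real k + 1" "real p + 1"] B by simp
  \<comment> \<open>For a zero exponent the integrands differ at an endpoint, since
    \<open>0 powr 0 = 0\<close> but \<open>0 ^ 0 = 1\<close>; two points are negligible.\<close>
  then show ?thesis
    by (rule has_integral_spike[of "{0, 1}", rotated 2]) (auto simp: powr_realpow)
qed

lemma scaled_beta_eq_hypergeo_coeff:
  "(real p + 1) * ((lam - 1) gchoose k) * (- 1) ^ k * (fact k * fact p / fact (k + p + 1)) =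
    fps_nth (fps_hypergeo [1 - lam, 1] [real p + 2] 1) k"
proof -
  \<comment> \<open>Split the product \<open>1 * 2 * ... * (p + 1 + k)\<close> after its first
    \<open>p + 1\<close> factors.\<close>
  have "pochhammer (real p + 2) k * fact (p + 1) = fact (k + p + 1)"
  proof -
    have "(fact (p + 1 + k) :: real) = pochhammer 1 (p + 1 + k)"
      by (simp add: pochhammer_fact)
    also have "\<dots> = fact (p + 1) * pochhammer (1 + real (p + 1)) k"
      by (simp only: pochhammer_product' pochhammer_fact of_nat_add of_nat_1)
    finally show ?thesis by (simp add: add_ac mult_ac)
  qed
  then have poch: "fact (k + p + 1) = pochhammer (real p + 2) k * ((real p + 1) * fact p)"
    by (simp add: algebra_simps)
  have nz: "real p + 1 \<noteq> 0" by linarith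
  \<comment> \<open>The two signs \<open>(- 1) ^ k\<close> cancel, and the numerator parameter 1
    contributes \<open>pochhammer 1 k = fact k\<close>, which cancels the factorial in the
    hypergeometric coefficient.\<close>
  show ?thesis
    unfolding poch using nz
    by (simp add: gbinomial_pochhammer flip: pochhammer_fact power_mult_distrib)
qed

theorem theorem6:
  fixes lam :: real and p :: nat
  shows "Abs_fps (\<lambda>n. deg_bernoulli lam (int p) n / fact n) =
    fps_const (real p + 1) *
      fps_integral_coeffwise (fps_const ((1 - [:0, 1:]) ^ p) * deg_binomial_power lam)"
proof (rule fps_ext)
  fix n
  define u where "u = 1 - deg_exp lam"
  \<comment> \<open>\<open>c k\<close> gathers the factors free of \<open>x\<close>. Only
    \<open>k \<le> n\<close> matters because \<open>u\<close> has constant term 0.\<close>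
  define c where "c = (\<lambda>k. ((lam - 1) gchoose k) * (- 1) ^ k * fps_nth (u ^ k) n)"
  have poly_eq: "poly (fps_nth (fps_const ((1 - [:0, 1:]) ^ p) * deg_binomial_power lam) n) x =
      (\<Sum>k=0..n. c k * (x ^ k * (1 - x) ^ p))" for x
  proof -
    have "poly (fps_nth (deg_binomial_power lam) n) x =
        (\<Sum>k=0..n. ((lam - 1) gchoose k) * (- x) ^ k * fps_nth (u ^ k) n)"
      by (simp add: deg_binomial_power_def fps_compose_nth poly_sum u_def[symmetric]
          fps_const_coeffs_nth mult_ac flip: fps_const_coeffs_power)
    also have "\<dots> = (\<Sum>k=0..n. c k * x ^ k)"
      by (intro sum.cong) (simp_all add: c_def power_minus[of x])
    finally show ?thesis
      by (simp add: sum_distrib_left mult_ac)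
  qed
  \<comment> \<open>The sum is finite, so integrating term by term raises no convergence
    question.\<close>
  have "((\<lambda>x. \<Sum>k=0..n. c k * (x ^ k * (1 - x) ^ p)) has_integral
      (\<Sum>k=0..n. c k * (fact k * fact p / fact (k + p + 1)))) {0..1}"
    by (intro has_integral_sum has_integral_mult_right has_integral_power_mult_one_minus_power) simp
  then have "fps_nth (fps_integral_coeffwise
        (fps_const ((1 - [:0, 1:]) ^ p) * deg_binomial_power lam)) n =
      (\<Sum>k=0..n. c k * (fact k * fact p / fact (k + p + 1)))"
    unfolding fps_integral_coeffwise_def fps_nth_Abs_fps poly_eq[symmetric]
    by (rule integral_unique)
  then have "fps_nth (fps_const (real p + 1) *
      fps_integral_coeffwise (fps_const ((1 - [:0, 1:]) ^ p) * deg_binomial_power lam)) n =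
      (real p + 1) * (\<Sum>k=0..n. c k * (fact k * fact p / fact (k + p + 1)))"
    by simp
  also have "\<dots> = (\<Sum>k=0..n. fps_nth (fps_hypergeo [1 - lam, 1] [real p + 2] 1) k * fps_nth (u ^ k) n)"
    unfolding sum_distrib_left scaled_beta_eq_hypergeo_coeff[symmetric] c_def
    by (intro sum.cong) (simp_all add: mult_ac)
  also have "\<dots> = fps_nth (Abs_fps (\<lambda>n. deg_bernoulli lam (int p) n / fact n)) n"
    by (simp add: deg_bernoulli_def fps_compose_nth u_def)
  finally show "fps_nth (Abs_fps (\<lambda>n. deg_bernoulli lam (int p) n / fact n)) n =
    fps_nth (fps_const (real p + 1) *
      fps_integral_coeffwise (fps_const ((1 - [:0, 1:]) ^ p) * deg_binomial_power lam)) n" ..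
qed

end
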